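(* Let $x\in[0,1]$ and assume that the base-$2$ expansion $w(x,2)\in\{0,1\}^\omega$ of $x$ is a pure morphic word. Then $x$ satisfies the $2$-adic Littlewood conjecture, i.e. $\liminf_{q\to\infty} q\cdot|q|_2\cdot\|qx\|=0$.
   Context: Here $q$ runs over the positive integers, $|\cdot|_2$ is the $2$-adic absolute value and $\|\cdot\|$ is the distance to the nearest integer. The base-$2$ expansion of $x\in[0,1]$ is the infinite word $w(x,2)=a_1a_2\cdots$ on $\{0,1\}$ with $x=\sum_{i\ge1}a_i2^{-i}$; it is unique unless $x$ is a rational number with denominator a power of $2$ (rational numbers trivially satisfy the conjecture). $\mathcal{A}^*$ is the set of finite words over a finite alphabet $\mathcal{A}$, including the empty word $\epsilon$. Given a morphism $\phi:\mathcal{A}\to\mathcal{A}^*$ (extended to words by concatenation), a letter $c$ is mortal if $\phi^j(c)=\epsilon$ for some $j\ge1$; $M_\phi$ is the set of mortal letters. The morphism $\phi$ is prolongable on $a\in\mathcal{A}$ if $\phi(a)=ay$ with $y\notin M_\phi^*$. In this case $a,\phi(a),\phi^2(a),\ldots$ converge to the infinite word $\phi^\omega(a)=ay\,\phi(y)\,\phi^2(y)\cdots$; words of this form are called pure morphic words. For a pure morphic word in $\{0,1\}^\omega$ the morphism is $\phi:\{0,1\}\to\{0,1\}^*$. *)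

theory Defs
  imports Complex_Main "HOL-Library.Extended_Real" "HOL-Computational_Algebra.Primes"
begin

text \<open>
  Infinite words are functions on \<^typ>\<open>nat\<close>, so the letter \<open>a\<^sub>i\<close> (\<open>i \<ge> 1\<close>) of a word
  \<open>w = a\<^sub>1 a\<^sub>2 \<dots>\<close> is \<open>w (i - 1)\<close>. The binary alphabet is \<^typ>\<open>bool\<close>, with \<^term>\<open>False\<close> for
  the letter 0 and \<^term>\<open>True\<close> for the letter 1.
\<close>

definition morph_ext :: "('a \<Rightarrow> 'a list) \<Rightarrow> 'a list \<Rightarrow> 'a list" where
  "morph_ext \<phi> u = concat (map \<phi> u)"

definition mortal_letters :: "('a \<Rightarrow> 'a list) \<Rightarrow> 'a set" where
  "mortal_letters \<phi> = {c. \<exists>j\<ge>1. (morph_ext \<phi> ^^ j) [c] = []}"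

definition prolongable :: "('a \<Rightarrow> 'a list) \<Rightarrow> 'a \<Rightarrow> bool" where
  "prolongable \<phi> a \<longleftrightarrow> (\<exists>y. \<phi> a = a # y \<and> y \<notin> lists (mortal_letters \<phi>))"

definition words_converge :: "(nat \<Rightarrow> 'a list) \<Rightarrow> (nat \<Rightarrow> 'a) \<Rightarrow> bool" where
  "words_converge u w \<longleftrightarrow> (\<forall>i. \<forall>\<^sub>F n in sequentially. i < length (u n) \<and> u n ! i = w i)"

text \<open>The morphism acts on the alphabet of the word itself: no coding is allowed.\<close>

definition pure_morphic :: "(nat \<Rightarrow> 'a::finite) \<Rightarrow> bool" where
  "pure_morphic w \<longleftrightarrow>
     (\<exists>\<phi> a. prolongable \<phi> a \<and> words_converge (\<lambda>n. (morph_ext \<phi> ^^ n) [a]) w)"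

text \<open>
  A relation rather than a function of \<open>x\<close>: a rational number whose denominator is a power of 2
  can have two expansions.
\<close>

definition base2_expansion :: "real \<Rightarrow> (nat \<Rightarrow> bool) \<Rightarrow> bool" where
  "base2_expansion x w \<longleftrightarrow> (\<lambda>i. of_bool (w i) / 2 ^ Suc i) sums x"

definition padic_abs :: "nat \<Rightarrow> nat \<Rightarrow> real" where
  "padic_abs p q = (if q = 0 then 0 else 1 / real p ^ multiplicity p q)"

definition dist_nearest_int :: "real \<Rightarrow> real" where
  "dist_nearest_int y = \<bar>y - of_int (round y)\<bar>"

end

theory Submission
  imports Defs
begin

text \<open>
  If a factor of length \<open>l + N\<close> at position \<open>i\<close> of \<open>w\<close> agrees with its shift by \<open>l\<close>,
  then \<open>q = 2\<^sup>i (2\<^sup>l - 1)\<close> gives \<open>q \<cdot> |q|\<^sub>2 \<cdot> \<parallel>q x\<parallel> \<le> 2\<^sup>-\<^sup>N\<close>; if it is complementary to its shift,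
  \<open>q = 2\<^sup>i (2\<^sup>l + 1)\<close> does the same up to a factor 2. So it suffices to find such factors with
  \<open>N\<close> unbounded.

  Let \<open>w\<close> be generated by \<open>\<phi>\<close>. If \<open>w\<close> contains an overlap \<open>c v c v c\<close> and the images \<open>\<phi>\<^sup>n(c)\<close>
  grow, then \<open>\<phi>\<^sup>n(c v c v c)\<close> has period \<open>|\<phi>\<^sup>n(c v)|\<close> and an excess \<open>|\<phi>\<^sup>n(c)|\<close> over a square. Only
  the letter \<open>b\<close> other than the initial one can fail to grow, namely if \<open>\<phi>(b)\<close> is empty or \<open>b\<close>, and
  these two cases are handled directly. If \<open>w\<close> is overlap-free, it contains the third
  Thue--Morse iterate \<open>c d d c d c c d\<close> of a letter, and overlap-freeness of its image under \<open>\<phi>\<^sup>n\<close> forces \<open>\<phi>\<^sup>n(d)\<close>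
  to be the complement of \<open>\<phi>\<^sup>n(c)\<close>, as in the theorem of Berstel and Seebold. Hence \<open>\<phi>\<^sup>n(c d c)\<close>
  is complementary to its shift by \<open>|\<phi>\<^sup>n(c)|\<close>.
\<close>

subsection \<open>Overlaps in binary words\<close>

text \<open>What is forbidden is period \<open>p\<close> on a window of length
  \<open>2 * p + 1\<close>, one letter more than a square. The bound \<open>n\<close> lets the
  predicate serve prefixes of infinite words and, through \<open>(!)\<close>, finite lists.\<close>

definition overlap_free :: "(nat \<Rightarrow> bool) \<Rightarrow> nat \<Rightarrow> bool" where
  "overlap_free W n \<longleftrightarrow>
     (\<forall>i p. 1 \<le> p \<longrightarrow> i + 2 * p < n \<longrightarrow> (\<exists>j\<le>p. W (i + j) \<noteq> W (i + j + p)))"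

definition overlap_free_list :: "bool list \<Rightarrow> bool" where
  "overlap_free_list u \<longleftrightarrow> overlap_free ((!) u) (length u)"

lemma overlap_freeD:
  assumes "overlap_free W n" "1 \<le> p" "i + 2 * p < n" "\<And>j. j \<le> p \<Longrightarrow> W (i + j) = W (i + j + p)"
  shows False
  using assms unfolding overlap_free_def by blast

lemma le3_cases: "(j::nat) \<le> 3 \<Longrightarrow> j = 0 \<or> j = 1 \<or> j = 2 \<or> j = 3"
  by arith

lemma no_cube:
  assumes "overlap_free W n" "i + 2 < n" "W i = W (i + 1)"
  shows "W (i + 2) \<noteq> W (i + 1)"
proof
  assume "W (i + 2) = W (i + 1)"
  then have "W (i + j) = W (i + j + 1)" if "j \<le> 1" for j
    using assms(3) that by (cases "j = 0") (auto simp: le_Suc_eq)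
  then show False
    using overlap_freeD[OF assms(1), of 1 i] assms(2) by auto
qed

text \<open>Five alternating letters would form an overlap of period 2.\<close>

lemma double_within_5:
  assumes "overlap_free W n" "i + 4 < n"
  shows "\<exists>k<4. W (i + k) = W (i + k + 1)"
proof (rule ccontr)
  assume "\<not> ?thesis"
  then have n: "W (i + k) \<noteq> W (i + k + 1)" if "k < 4" for k using that by blast
  have "W (i + j) = W (i + j + 2)" if "j \<le> 2" for j
    using n[of j] n[of "j + 1"] that by (auto simp: add.assoc numeral_2_eq_2)
  then show False using overlap_freeD[OF assms(1), of 2 i] assms(2) by auto
qed

text \<open>By induction it suffices to treat consecutive doubles. Odd distance 1 is a cube,
  distance 3 gives an overlap of period 3, and from distance 5 on another double must lie in
  between. The bounds on \<open>i\<close> and \<open>j\<close> provide one further letter on either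
  side, as distance 3 requires.\<close>

lemma even_distance_doubles:
  assumes W: "overlap_free W n"
  shows "\<lbrakk>1 \<le> i; i \<le> j; j + 2 < n; W i = W (i + 1); W j = W (j + 1)\<rbrakk> \<Longrightarrow> even (j - i)"
proof (induction "j - i" arbitrary: i j rule: less_induct)
  case less
  show ?case
  proof (cases "\<exists>k. i < k \<and> k < j \<and> W k = W (k + 1)")
    case True
    then obtain k where k: "i < k" "k < j" "W k = W (k + 1)" by blast
    have "even (k - i)" using less.hyps[of k i] less.prems k by auto
    moreover have "even (j - k)" using less.hyps[of j k] less.prems k by auto
    moreover have "j - i = (j - k) + (k - i)" using k by simp
    ultimately show ?thesis by simp
  next
    case False
    show ?thesis
    proof (rule ccontr)
      assume "odd (j - i)"
      then obtain d where d: "j = i + (2 * d + 1)"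
        using less.prems(2) by (metis le_add_diff_inverse oddE)
      consider "d = 0" | "d = 1" | "d \<ge> 2" by linarith
      then show False
      proof cases
        case 1
        then show False using no_cube[OF W, of i] less.prems d by auto
      next
        case 2
        \<comment> \<open>The two doubles with their outer neighbours spell
          \<open>y x x y x x y\<close>, starting at \<open>h\<close>.\<close>
        define h where "h = i - 1"
        have i: "i = h + 1" using less.prems h_def by simp
        have j: "j = h + 4" using i d 2 by simp
        have "W (h+2) \<noteq> W (h+3)" "W (h+3) \<noteq> W (h+4)"
          using False i j by (auto simp: numeral_eq_Suc)
        moreover have "W (h+1) = W (h+2)" "W (h+4) = W (h+5)"
          using less.prems i j by (auto simp: numeral_eq_Suc)
        moreover have "W (h + 6) \<noteq> W (h + 5)"
          using no_cube[OF W, of j] less.prems j by (auto simp: numeral_eq_Suc)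
        moreover have "W h \<noteq> W (h + 1)"
          using no_cube[OF W, of h] less.prems i by (auto simp: numeral_eq_Suc)
        ultimately have "W (h + j) = W (h + j + 3)" if "j \<le> 3" for j
          using le3_cases[OF that] by (auto simp: add.assoc)
        then show False using overlap_freeD[OF W, of 3 h] less.prems j by auto
      next
        case 3
        have "\<exists>k<4. W (i + 1 + k) = W (i + 1 + k + 1)"
          by (rule double_within_5[OF W]) (use less.prems d 3 in auto)
        then obtain k where k: "k < 4" "W (i + 1 + k) = W (i + 1 + k + 1)" by blast
        moreover have "i < i + 1 + k" "i + 1 + k < j" using k d 3 by auto
        ultimately show False using False by blast
      qed
    qed
  qed
qed

text \<open>All doubles beyond position 0 have positions of one parity, so from a start of the other
  parity the word splits into blocks of two distinct letters, each determined by its first letter.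
  An overlap of period \<open>p\<close> in \<open>V\<close> would become one of period
  \<open>2 * p\<close> in \<open>W\<close>.\<close>

lemma thue_morse_desubstitution:
  assumes "\<And>n. overlap_free W n"
  shows "\<exists>k V. (\<forall>i. W (k + 2 * i) = V i \<and> W (k + 2 * i + 1) = (\<not> V i)) \<and> (\<forall>n. overlap_free V n)"
proof -
  obtain d where d: "W (1 + d) = W (1 + d + 1)"
    using double_within_5[OF assms, of 1 6] by auto
  \<comment> \<open>One past the double at \<open>1 + d\<close>, so that a double at any
    \<open>k + 2 * i\<close> would lie at odd distance from it.\<close>
  define k where "k = d + 2"
  define V where "V i = W (k + 2 * i)" for i
  have W: "W (k + 2 * i + 1) = (\<not> V i)" for i
  proof (rule ccontr)
    assume "\<not> ?thesis"
    then have "even ((k + 2 * i) - (1 + d))"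
      using d by (intro even_distance_doubles[OF assms[of "k + 2 * i + 3"]]) (auto simp: k_def V_def)
    then show False by (simp add: k_def)
  qed
  have "overlap_free V n" for n
    unfolding overlap_free_def
  proof (intro allI impI, rule ccontr)
    fix i p assume p: "1 \<le> p" and "\<not> (\<exists>j\<le>p. V (i + j) \<noteq> V (i + j + p))"
    then have eq: "V (i + j) = V (i + j + p)" if "j \<le> p" for j using that by blast
    have "W (k + 2 * i + j) = W (k + 2 * i + j + 2 * p)" if "j \<le> 2 * p" for j
    proof (cases "even j")
      case True
      then obtain m where m: "j = 2 * m" by blast
      then have "W (k + 2 * (i + m)) = W (k + 2 * (i + m + p))"
        using eq[of m] that unfolding V_def by simp
      then show ?thesis by (simp add: m algebra_simps)
    next
      case False
      then obtain m where m: "j = 2 * m + 1" by (rule oddE)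
      then have "W (k + 2 * (i + m) + 1) = W (k + 2 * (i + m + p) + 1)"
        using eq[of m] that unfolding W by simp
      then show ?thesis by (simp add: m algebra_simps)
    qed
    then show False
      using overlap_freeD[OF assms[of "k + 2 * i + 2 * (2 * p) + 1"], of "2 * p" "k + 2 * i"] p by auto
  qed
  then show ?thesis using W V_def by blast
qed

definition factor_of :: "'a list \<Rightarrow> (nat \<Rightarrow> 'a) \<Rightarrow> bool" where
  "factor_of u w \<longleftrightarrow> (\<exists>i. \<forall>j<length u. w (i + j) = u ! j)"

definition tm8 :: "bool \<Rightarrow> bool list" where
  "tm8 c = [c, \<not> c, \<not> c, c, \<not> c, c, c, \<not> c]"

text \<open>After three desubstitutions, one letter of the top word unfolds to 2, 4 and finally 8
  letters of \<open>W\<close>.\<close>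

lemma tm8_factor:
  assumes "\<And>n. overlap_free W n"
  shows "\<exists>c. factor_of (tm8 c) W"
proof -
  obtain k V where V: "\<And>i. W (k + 2 * i) = V i" "\<And>i. W (k + 2 * i + 1) = (\<not> V i)"
    "\<And>n. overlap_free V n" using thue_morse_desubstitution[OF assms] by blast
  obtain k' V' where V': "\<And>i. V (k' + 2 * i) = V' i" "\<And>i. V (k' + 2 * i + 1) = (\<not> V' i)"
    "\<And>n. overlap_free V' n" using thue_morse_desubstitution[OF V(3)] by blast
  obtain m V'' where V'': "\<And>i. V' (m + 2 * i) = V'' i" "\<And>i. V' (m + 2 * i + 1) = (\<not> V'' i)"
    "\<And>n. overlap_free V'' n" using thue_morse_desubstitution[OF V'(3)] by blast
  define c where "c = V'' 0"
  have 1: "V' m = c" "V' (m + 1) = (\<not> c)" using V''(1,2)[of 0] by (auto simp: c_def)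
  define l where "l = k' + 2 * m"
  have 2: "V l = c" "V (l + 1) = (\<not> c)" "V (l + 2) = (\<not> c)" "V (l + 3) = c"
    using V'(1,2)[of m] V'(1,2)[of "m + 1"] 1 by (auto simp: l_def numeral_eq_Suc)
  have "\<forall>j<length (tm8 c). W ((k + 2 * l) + j) = tm8 c ! j"
    using V(1,2)[of l] V(1,2)[of "l + 1"] V(1,2)[of "l + 2"] V(1,2)[of "l + 3"] 2
    by (auto simp: tm8_def numeral_eq_Suc less_Suc_eq)
  then show ?thesis unfolding factor_of_def by blast
qed

section \<open>Overlaps as lists\<close>

lemma nth_append_middle: "k < length v \<Longrightarrow> (u @ v @ r) ! (length u + k) = v ! k"
  by (simp add: nth_append)

lemma not_overlap_free_list: "\<not> overlap_free_list (u @ (c # v) @ (c # v) @ c # r)"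
proof
  let ?W = "u @ (c # v) @ (c # v) @ c # r" and ?p = "Suc (length v)"
  assume *: "overlap_free_list ?W"
  have "?W ! (length u + j) = ?W ! (length u + j + ?p)" if "j \<le> ?p" for j
  proof -
    have "?W ! (length u + j) = ((c # v) @ [c]) ! j"
      using that nth_append_middle[of j "(c # v) @ [c]" u "v @ c # r"] by simp
    moreover have "?W ! (length (u @ c # v) + j) = ((c # v) @ [c]) ! j"
      using that nth_append_middle[of j "(c # v) @ [c]" "u @ c # v" r] by simp
    ultimately show ?thesis by (simp add: algebra_simps)
  qed
  then show False
    using overlap_freeD[OF *[unfolded overlap_free_list_def], of ?p "length u"] by simp
qed

lemma overlap_of_not_free:
  assumes "\<not> overlap_free W n"
  shows "\<exists>c v. factor_of ((c # v) @ (c # v) @ [c]) W"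
proof -
  obtain i p where p: "1 \<le> p" and eq: "\<And>j. j \<le> p \<Longrightarrow> W (i + j) = W (i + j + p)"
    using assms unfolding overlap_free_def by blast
  define u where "u = map (\<lambda>j. W (i + j)) [0..<p]"
  have u: "length u = p" "\<And>j. j < p \<Longrightarrow> u ! j = W (i + j)" by (auto simp: u_def)
  have "u \<noteq> []" using u p by auto
  then obtain c v where cv: "u = c # v" by (cases u) auto
  have c: "c = W i" using u(2)[of 0] p cv by simp
  have "W (i + j) = (u @ u @ [c]) ! j" if "j < length (u @ u @ [c])" for j
  proof -
    have "j \<le> 2 * p" using that u(1) by simp
    then consider "j < p" | "p \<le> j" "j < 2 * p" | "j = 2 * p" by linarith
    then show ?thesis
    proof cases
      case 1 then show ?thesis by (simp add: nth_append u)
    next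
      case 2
      then have "j - p < p" by linarith
      then show ?thesis using 2 eq[of "j - p"] by (simp add: nth_append u)
    next
      case 3 then show ?thesis using eq[of p] eq[of 0] by (simp add: nth_append u c mult_2 add.assoc)
    qed
  qed
  then show ?thesis using cv unfolding factor_of_def by blast
qed

subsection \<open>Overlap-free images of the Thue--Morse word\<close>

abbreviation thue_morse :: "bool list \<Rightarrow> bool list" where
  "thue_morse \<equiv> morph_ext (\<lambda>c. [c, \<not> c])"

lemma morph_ext_simps [simp]:
  "morph_ext \<phi> [] = []" "morph_ext \<phi> (c # u) = \<phi> c @ morph_ext \<phi> u"
  "morph_ext \<phi> (u @ v) = morph_ext \<phi> u @ morph_ext \<phi> v"
  by (auto simp: morph_ext_def)

lemma thue_morse_nth:
  "length (thue_morse u) = 2 * length u"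
  "i < length u \<Longrightarrow> thue_morse u ! (2 * i) = u ! i"
  "i < length u \<Longrightarrow> thue_morse u ! (2 * i + 1) = (\<not> u ! i)"
proof (induction u arbitrary: i)
  case (Cons c u)
  { case 1 then show ?case using Cons.IH by simp }
  { case 2 then show ?case using Cons.IH(2) by (cases i) auto }
  { case 3 then show ?case using Cons.IH(3) by (cases i) auto }
qed auto

lemma thue_morse_Not: "thue_morse (map Not u) = map Not (thue_morse u)"
  by (induction u) auto

lemma thue_morse_preimage:
  assumes "even (length u)" "\<And>i. 2 * i + 1 < length u \<Longrightarrow> u ! (2 * i) \<noteq> u ! (2 * i + 1)"
  shows "\<exists>v. u = thue_morse v"
  using assms
proof (induction "length u" arbitrary: u rule: less_induct)
  case less
  show ?case
  proof (cases u)
    case Nil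
    then have "u = thue_morse []" by simp
    then show ?thesis by blast
  next
    case (Cons c u')
    then obtain d r where u: "u = c # d # r" using less.prems(1) by (cases u') auto
    have "\<exists>v. r = thue_morse v"
    proof (rule less.hyps)
      fix i assume "2 * i + 1 < length r"
      then show "r ! (2 * i) \<noteq> r ! (2 * i + 1)" using less.prems(2)[of "i + 1"] u by simp
    qed (use less.prems u in auto)
    then obtain v where "r = thue_morse v" by blast
    moreover have "d = (\<not> c)" using less.prems(2)[of 0] u by auto
    ultimately have "u = thue_morse (c # v)" using u by simp
    then show ?thesis by blast
  qed
qed

lemma overlap_free_thue_morseD:
  assumes "overlap_free_list (thue_morse u)"
  shows "overlap_free_list u"
  unfolding overlap_free_list_def overlap_free_def
proof (intro allI impI, rule ccontr)
  fix i p assume p: "1 \<le> p" "i + 2 * p < length u" and "\<not> (\<exists>j\<le>p. u ! (i + j) \<noteq> u ! (i + j + p))"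
  then have eq: "u ! (i + j) = u ! (i + j + p)" if "j \<le> p" for j using that by blast
  let ?W = "thue_morse u"
  have "?W ! (2 * i + j) = ?W ! (2 * i + j + 2 * p)" if "j \<le> 2 * p" for j
  proof (cases "even j")
    case True
    then obtain m where m: "j = 2 * m" by blast
    then have "?W ! (2 * (i + m)) = ?W ! (2 * (i + m + p))"
      using eq[of m] that p thue_morse_nth(2)[of "i + m" u] thue_morse_nth(2)[of "i + m + p" u] by simp
    then show ?thesis by (simp add: m algebra_simps)
  next
    case False
    then obtain m where m: "j = 2 * m + 1" by (rule oddE)
    then have "?W ! (2 * (i + m) + 1) = ?W ! (2 * (i + m + p) + 1)"
      using eq[of m] that p thue_morse_nth(3)[of "i + m" u] thue_morse_nth(3)[of "i + m + p" u] by simp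
    then show ?thesis by (simp add: m algebra_simps)
  qed
  then show False
    using overlap_freeD[OF assms[unfolded overlap_free_list_def], of "2 * p" "2 * i"] p
    by (auto simp: thue_morse_nth(1))
qed

text \<open>Induction on the length of \<open>A\<close>. Equal first or equal last letters of
  \<open>A\<close> and \<open>B\<close> would extend the square \<open>B B\<close> to an overlap, so
  both differ. If both lengths are even and a double sits at an odd position, \<open>A\<close> and
  \<open>B\<close> are Thue--Morse images and their preimages form a smaller instance. In the
  remaining case both words alternate, which leaves only single letters.\<close>

lemma complement_of_overlap_free_tm8:
  assumes "overlap_free_list (A @ B @ B @ A @ B @ A @ A @ B)" "A \<noteq> [] \<or> B \<noteq> []"
  shows "B = map Not A"
  using assms
proof (induction "length A" arbitrary: A B rule: less_induct)
  case less
  note free = less.prems(1)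
  let ?Z = "A @ B @ B @ A @ B @ A @ A @ B"
  have A0: "A \<noteq> []"
  proof
    assume "A = []"
    then show False using less.prems not_overlap_free_list[of "[]" "hd B" "tl B" "tl B @ B"]
      by (cases B) auto
  qed
  have B0: "B \<noteq> []"
  proof
    assume "B = []"
    then show False using less.prems not_overlap_free_list[of "[]" "hd A" "tl A" "tl A @ A"]
      by (cases A) auto
  qed
  have hd: "hd A \<noteq> hd B"
  proof
    assume eq: "hd A = hd B"
    obtain c a where A: "A = c # a" using A0 by (cases A) auto
    obtain d b where "B = d # b" using B0 by (cases B) auto
    then have B: "B = c # b" using eq A by simp
    show False using free not_overlap_free_list[of A c b "a @ B @ A @ A @ B"] A B by simp
  qed
  have last: "last A \<noteq> last B"
  proof
    assume eq: "last A = last B"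
    obtain a c where A: "A = a @ [c]" using A0 by (cases A rule: rev_cases) auto
    obtain b d where "B = b @ [d]" using B0 by (cases B rule: rev_cases) auto
    then have B: "B = b @ [c]" using eq A by simp
    show False using free not_overlap_free_list[of a c b "A @ B @ A @ A @ B"] A B by simp
  qed
  define a b where "a = length A" and "b = length B"
  have ab: "0 < a" "0 < b" using A0 B0 by (auto simp: a_def b_def)
  define W where "W = (!) ?Z"
  have "length ?Z = 4 * a + 4 * b" by (simp add: a_def b_def)
  then have W: "overlap_free W (4 * a + 4 * b)"
    using free unfolding overlap_free_list_def W_def by simp
  have occ: "W (n + k) = v ! k" if "?Z = u @ v @ r" "length u = n" "k < length v" for u v r n k
    using nth_append_middle[OF that(3), of u r] unfolding W_def that(1) that(2) .
  have pos: "W (a + k) = B ! k" "W (a + b + k) = B ! k" "W (2 * a + 2 * b + k) = B ! k"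
    if "k < b" for k
    using occ[of A B "B @ A @ B @ A @ A @ B" a k] occ[of "A @ B" B "A @ B @ A @ A @ B" "a + b" k]
      occ[of "A @ B @ B @ A" B "A @ A @ B" "2 * a + 2 * b" k] that
    by (simp_all add: a_def b_def)
  have posA: "W (a + 2 * b + k) = A ! k" "W (2 * a + 3 * b + k) = A ! k"
      "W (3 * a + 3 * b + k) = A ! k" if "k < a" for k
    using occ[of "A @ B @ B" A "B @ A @ A @ B" "a + 2 * b" k]
      occ[of "A @ B @ B @ A @ B" A "A @ B" "2 * a + 3 * b" k]
      occ[of "A @ B @ B @ A @ B @ A" A B "3 * a + 3 * b" k] that
    by (simp_all add: a_def b_def)
  have par: "even (j - i)" if "1 \<le> i" "i \<le> j" "j + 2 < 4 * a + 4 * b" "W i = W (i + 1)" "W j = W (j + 1)" for i j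
    using even_distance_doubles[OF W] that by blast
  have hdW: "hd A = A ! 0" "hd B = B ! 0" "last A = A ! (a - 1)" "last B = B ! (b - 1)"
    using A0 B0 by (auto simp: hd_conv_nth last_conv_nth a_def b_def)
  \<comment> \<open>An odd double \<open>d\<close> excludes doubles at even positions from 2 on, and
    with \<open>a\<close> and \<open>b\<close> even these are where the two-letter blocks of inner
    copies of \<open>A\<close> and \<open>B\<close> start.\<close>
  have finish: ?case if ev: "even a" "even b" and d: "1 \<le> d" "d + 2 < 4 * a + 4 * b" "odd d" "W d = W (d + 1)" for d
  proof -
    have alt: "W (2 * i) \<noteq> W (2 * i + 1)" if "2 * i + 2 < 4 * a + 4 * b" "1 \<le> i" for i
    proof
      assume eq: "W (2 * i) = W (2 * i + 1)"
      show False
      proof (cases "d \<le> 2 * i")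
        case True
        then have "even (2 * i - d)" using par[of d "2 * i"] d eq that by blast
        then show False using d(3) True by simp
      next
        case False
        then have "even (d - 2 * i)" using par[of "2 * i" d] d eq that by simp
        then show False using d(3) False by simp
      qed
    qed
    \<comment> \<open>The copy of \<open>A\<close> at \<open>a + 2 * b\<close> is read, because
      \<open>alt\<close> says nothing about position 0.\<close>
    have "\<exists>v. A = thue_morse v"
    proof (rule thue_morse_preimage)
      fix i assume "2 * i + 1 < length A"
      then show "A ! (2 * i) \<noteq> A ! (2 * i + 1)"
        using alt[of "a div 2 + b + i"] posA(1)[of "2 * i"] posA(1)[of "2 * i + 1"] ev ab
        by (simp add: algebra_simps a_def[symmetric])
    qed (use ev a_def in auto)
    then obtain A' where A': "A = thue_morse A'" by blast
    have "\<exists>v. B = thue_morse v"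
    proof (rule thue_morse_preimage)
      fix i assume "2 * i + 1 < length B"
      then show "B ! (2 * i) \<noteq> B ! (2 * i + 1)"
        using alt[of "a + b + i"] pos(3)[of "2 * i"] pos(3)[of "2 * i + 1"] ev ab
        by (simp add: algebra_simps b_def[symmetric])
    qed (use ev b_def in auto)
    then obtain B' where B': "B = thue_morse B'" by blast
    have "overlap_free_list (A' @ B' @ B' @ A' @ B' @ A' @ A' @ B')"
      by (rule overlap_free_thue_morseD) (use free A' B' in simp)
    then have "B' = map Not A'"
      using A' A0 by (intro less.hyps) (auto simp: thue_morse_nth(1))
    then show ?case by (simp add: A' B' thue_morse_Not)
  qed
  show ?case
  proof (cases "last B = hd A")
    case True
    then have "last A = hd B" using hd last by blast
    \<comment> \<open>Three successive borders \<open>B A\<close>, \<open>A B\<close>,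
      \<open>B A\<close> carry doubles, at distances \<open>a\<close> and \<open>b\<close>.\<close>
    define i1 i2 i3 where "i1 = a + 2 * b - 1" and "i2 = 2 * a + 2 * b - 1" and "i3 = 2 * a + 3 * b - 1"
    have s: "i1 + 1 = a + 2 * b" "i2 + 1 = 2 * a + 2 * b" "i3 + 1 = 2 * a + 3 * b"
      using ab by (auto simp: i1_def i2_def i3_def)
    have "i1 = a + b + (b - 1)" "i2 = a + 2 * b + (a - 1)" "i3 = 2 * a + 2 * b + (b - 1)"
      using ab by (auto simp: i1_def i2_def i3_def)
    then have "W i1 = last B" "W i2 = last A" "W i3 = last B"
      using pos[of "b - 1"] posA[of "a - 1"] ab hdW by auto
    moreover have "W (i1 + 1) = hd A" "W (i2 + 1) = hd B" "W (i3 + 1) = hd A"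
      unfolding s using pos[of 0] posA[of 0] ab hdW by auto
    ultimately have d: "W i1 = W (i1 + 1)" "W i2 = W (i2 + 1)" "W i3 = W (i3 + 1)"
      using True \<open>last A = hd B\<close> by auto
    have "even (i2 - i1)" "even (i3 - i2)"
      by (rule par; use d ab in \<open>simp add: i1_def i2_def i3_def\<close>)+
    then have ev: "even a" "even b" using ab by (auto simp: i1_def i2_def i3_def)
    show ?thesis
      by (rule finish[OF ev _ _ _ d(2)]) (use ab in \<open>auto simp: i2_def\<close>)
  next
    case False
    then have lB: "last B = hd B" and lA: "last A = hd A" using hd last by blast+
    \<comment> \<open>The border inside the square \<open>B B\<close> is a double, at an odd
      position once \<open>a\<close> and \<open>b\<close> are even.\<close>
    define i0 where "i0 = a + b - 1"
    have i0: "i0 = a + (b - 1)" "i0 + 1 = a + b + 0" using ab by (auto simp: i0_def)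
    have d0: "W i0 = W (i0 + 1)"
      unfolding i0(2) using i0(1) pos(1)[of "b - 1"] pos(2)[of 0] lB hdW ab by simp
    show ?thesis
    proof (cases "(\<exists>k. k + 1 < a \<and> A ! k = A ! (k + 1)) \<or> (\<exists>k. k + 1 < b \<and> B ! k = B ! (k + 1))")
      case True
      \<comment> \<open>A double inside one word recurs in its other copies. Their offsets differ by
        \<open>a + b\<close> and by the length of that word, so both lengths are even.\<close>
      have "even a \<and> even b"
        using True
      proof
        assume "\<exists>k. k + 1 < a \<and> A ! k = A ! (k + 1)"
        then obtain k where k: "k + 1 < a" "A ! k = A ! (k + 1)" by blast
        have d: "W (a + 2 * b + k) = W (a + 2 * b + k + 1)"
          "W (2 * a + 3 * b + k) = W (2 * a + 3 * b + k + 1)"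
          "W (3 * a + 3 * b + k) = W (3 * a + 3 * b + k + 1)"
          using posA[of k] posA[of "k + 1"] k by (simp_all add: add.assoc)
        have "even ((2 * a + 3 * b + k) - (a + 2 * b + k))"
          "even ((3 * a + 3 * b + k) - (2 * a + 3 * b + k))"
          by (rule par; use d ab k in simp)+
        then show ?thesis by simp
      next
        assume "\<exists>k. k + 1 < b \<and> B ! k = B ! (k + 1)"
        then obtain k where k: "k + 1 < b" "B ! k = B ! (k + 1)" by blast
        have d: "W (a + k) = W (a + k + 1)" "W (a + b + k) = W (a + b + k + 1)"
          "W (2 * a + 2 * b + k) = W (2 * a + 2 * b + k + 1)"
          using pos[of k] pos[of "k + 1"] k by (simp_all add: add.assoc)
        have "even ((a + b + k) - (a + k))"
          "even ((2 * a + 2 * b + k) - (a + b + k))"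
          by (rule par; use d ab k in simp)+
        then show ?thesis by simp
      qed
      then have ev: "even a" "even b" by auto
      show ?thesis
        by (rule finish[OF ev _ _ _ d0]) (use ab ev in \<open>auto simp: i0_def\<close>)
    next
      case False
      then have altA: "\<And>k. k + 1 < a \<Longrightarrow> A ! k \<noteq> A ! (k + 1)"
        and altB: "\<And>k. k + 1 < b \<Longrightarrow> B ! k \<noteq> B ! (k + 1)" by blast+
      have AB: "last A \<noteq> hd B" and BA: "last B \<noteq> hd A" using lA lB hd by auto
      \<comment> \<open>Both \<open>A\<close> and \<open>B\<close> alternate and end as they begin, so the factor \<open>B A B A\<close> alternates.\<close>
      have alt: "W (a + b + k) \<noteq> W (a + b + k + 1)" if "k + 1 < 2 * b + 2 * a" for k
      proof -
        consider "k + 1 < b" | "k + 1 = b" | "b \<le> k" "k + 1 < b + a" | "k + 1 = b + a"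
          | "b + a \<le> k" "k + 1 < 2 * b + a" | "k + 1 = 2 * b + a" | "2 * b + a \<le> k" using that by linarith
        then show ?thesis
        proof cases
          case 1
          then show ?thesis using pos(2)[of k] pos(2)[of "k + 1"] altB[of k] by (simp add: add.assoc)
        next
          case 2
          have "a + b + k = a + b + (b - 1)" "a + b + k + 1 = a + 2 * b + 0"
            using 2 ab by simp_all
          then show ?thesis using pos(2)[of "b - 1"] posA(1)[of 0] BA ab hdW
            by (metis diff_less zero_less_one)
        next
          case 3
          define m where "m = k - b"
          have k: "k = b + m" using 3 by (simp add: m_def)
          show ?thesis
            using posA(1)[of m] posA(1)[of "m + 1"] altA[of m] 3
            by (simp add: k mult_2 add.assoc)
        next
          case 4
          have "a + b + k = a + 2 * b + (a - 1)" "a + b + k + 1 = 2 * a + 2 * b + 0"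
            using 4 ab by simp_all
          then show ?thesis using posA(1)[of "a - 1"] pos(3)[of 0] AB ab hdW
            by (metis diff_less zero_less_one)
        next
          case 5
          define m where "m = k - (b + a)"
          have k: "k = b + a + m" using 5 by (simp add: m_def)
          have e: "a + b + k = 2 * a + 2 * b + m" "a + b + k + 1 = 2 * a + 2 * b + (m + 1)"
            by (simp_all add: k)
          show ?thesis
            using pos(3)[of m] pos(3)[of "m + 1"] altB[of m] 5 unfolding e by (simp add: k)
        next
          case 6
          have "a + b + k = 2 * a + 2 * b + (b - 1)" "a + b + k + 1 = 2 * a + 3 * b + 0"
            using 6 ab by simp_all
          then show ?thesis using pos(3)[of "b - 1"] posA(2)[of 0] BA ab hdW
            by (metis diff_less zero_less_one)
        next
          case 7
          define m where "m = k - (2 * b + a)"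
          have k: "k = 2 * b + a + m" using 7 by (simp add: m_def)
          have e: "a + b + k = 2 * a + 3 * b + m" "a + b + k + 1 = 2 * a + 3 * b + (m + 1)"
            by (simp_all add: k)
          show ?thesis
            using posA(2)[of m] posA(2)[of "m + 1"] altA[of m] that unfolding e by (simp add: k)
        qed
      qed
      \<comment> \<open>Otherwise \<open>B A B A\<close> would contain five alternating
        letters.\<close>
      have "a = 1 \<and> b = 1"
      proof (rule ccontr)
        assume "\<not> (a = 1 \<and> b = 1)"
        then have "3 \<le> a + b" using ab by linarith
        then show False
          using double_within_5[OF W, of "a + b"] alt by fastforce
      qed
      then obtain p q where "A = [p]" "B = [q]"
        by (auto simp: a_def b_def length_Suc_conv)
      then show ?thesis using hd by auto
    qed
  qed
qed

subsection \<open>Almost periods and the Littlewood condition\<close>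

text \<open>For \<open>s = False\<close> the shift by \<open>l\<close> complements the letters.\<close>

definition nearly_periodic :: "(nat \<Rightarrow> bool) \<Rightarrow> bool" where
  "nearly_periodic w \<longleftrightarrow>
     (\<forall>K. \<exists>i l s. 1 \<le> l \<and> (\<forall>j<l + K. (w (i + j) = w (i + j + l)) = s))"

section \<open>Tails of binary expansions and distances to integers\<close>

lemma dist_nearest_int_le: "dist_nearest_int y \<le> \<bar>y - of_int n\<bar>"
  unfolding dist_nearest_int_def using round_diff_minimal[of y n] by simp

text \<open>With \<open>x = tail w 0\<close>, this represents \<open>2 ^ k * x\<close> modulo 1. It
  can equal 1, so it need not be the fractional part.\<close>

definition tail :: "(nat \<Rightarrow> bool) \<Rightarrow> nat \<Rightarrow> real" where
  "tail w k = (\<Sum>i. of_bool (w (k + i)) / 2 ^ Suc i)"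

lemma tail_summable: "summable (\<lambda>i. of_bool (w (k + i)) / 2 ^ Suc i :: real)"
proof (rule summable_comparison_test)
  show "\<exists>N. \<forall>n\<ge>N. norm (of_bool (w (k + n)) / 2 ^ Suc n :: real) \<le> (1 / 2) ^ n"
    by (auto simp: power_one_over divide_simps)
  show "summable (\<lambda>n. (1 / 2 :: real) ^ n)" by (rule summable_geometric) simp
qed

lemma tail_Suc: "2 * tail w k = of_bool (w k) + tail w (Suc k)"
proof -
  have "(\<Sum>i. of_bool (w (k + Suc i)) / 2 ^ Suc (Suc i)) = tail w k - of_bool (w k) / 2"
    unfolding tail_def using suminf_split_head[OF tail_summable[of w k]] by simp
  moreover have "(\<Sum>i. of_bool (w (k + Suc i)) / 2 ^ Suc (Suc i)) = tail w (Suc k) / 2"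
    unfolding tail_def using suminf_divide[OF tail_summable[of w "Suc k"], of 2]
    by (simp add: mult.commute)
  ultimately show ?thesis by simp
qed

lemma tail_bounds: "0 \<le> tail w k" "tail w k \<le> 1"
proof -
  show "0 \<le> tail w k" unfolding tail_def by (rule suminf_nonneg[OF tail_summable]) simp
  have "tail w k \<le> (\<Sum>i. (1 / 2) ^ Suc i)"
    unfolding tail_def using power_half_series
    by (intro suminf_le tail_summable) (auto simp: power_one_over sums_iff)
  also have "\<dots> = 1" using power_half_series by (simp add: sums_iff)
  finally show "tail w k \<le> 1" .
qed

lemma tail_diff_le:
  "(\<And>j. j < N \<Longrightarrow> w (k + j) = w (l + j)) \<Longrightarrow> \<bar>tail w k - tail w l\<bar> \<le> 1 / 2 ^ N"
proof (induction N arbitrary: k l)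
  case 0
  then show ?case using tail_bounds[of w k] tail_bounds[of w l] by auto
next
  case (Suc N)
  have "\<bar>tail w (Suc k) - tail w (Suc l)\<bar> \<le> 1 / 2 ^ N"
    by (rule Suc.IH) (use Suc.prems[of "Suc _"] in auto)
  moreover have "w k = w l" using Suc.prems[of 0] by simp
  ultimately show ?case using tail_Suc[of w k] tail_Suc[of w l] by simp
qed

text \<open>Fully complementary digits add up to 0.111... = 1 in base 2, which explains the
  subtracted 1.\<close>

lemma tail_sum_le:
  "(\<And>j. j < N \<Longrightarrow> w (k + j) \<noteq> w (l + j)) \<Longrightarrow> \<bar>tail w k + tail w l - 1\<bar> \<le> 1 / 2 ^ N"
proof (induction N arbitrary: k l)
  case 0
  then show ?case using tail_bounds[of w k] tail_bounds[of w l] by auto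
next
  case (Suc N)
  have "\<bar>tail w (Suc k) + tail w (Suc l) - 1\<bar> \<le> 1 / 2 ^ N"
    by (rule Suc.IH) (use Suc.prems[of "Suc _"] in auto)
  moreover have "w k \<noteq> w l" using Suc.prems[of 0] by simp
  ultimately show ?case using tail_Suc[of w k] tail_Suc[of w l] by (cases "w k") auto
qed

lemma tail_shift: "\<exists>n. 2 ^ k * tail w 0 = of_int n + tail w k"
proof (induction k)
  case 0
  show ?case by (rule exI[of _ 0]) simp
next
  case (Suc k)
  then obtain n where "2 ^ k * tail w 0 = of_int n + tail w k" by blast
  then have "2 ^ Suc k * tail w 0 = of_int (2 * n + of_bool (w k)) + tail w (Suc k)"
    using tail_Suc[of w k] by simp
  then show ?case by blast
qed

text \<open>The power of 2 costs nothing, so the position at which a repetition starts does not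
  affect the bound.\<close>

lemma mult_padic_abs_2:
  assumes "odd m"
  shows "real (2 ^ k * m) * padic_abs 2 (2 ^ k * m) = real m"
proof -
  have "m \<noteq> 0" using assms by (cases m) auto
  have "multiplicity 2 (2 ^ k * m) = k"
    by (rule multiplicity_eqI) (use assms \<open>m \<noteq> 0\<close> in \<open>auto\<close>)
  then show ?thesis using \<open>m \<noteq> 0\<close> by (simp add: padic_abs_def)
qed

lemma small_value_of_repetition:
  assumes l: "1 \<le> l" and s: "\<forall>j<N. (w (i + j) = w (i + j + l)) = s"
  shows "\<exists>q\<ge>2 ^ i. real q * padic_abs 2 q * dist_nearest_int (real q * tail w 0) \<le> 2 ^ (l + 1) / 2 ^ N"
proof -
  obtain n1 where n1: "2 ^ i * tail w 0 = of_int n1 + tail w i" using tail_shift by blast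
  obtain n2 where n2: "2 ^ (i + l) * tail w 0 = of_int n2 + tail w (i + l)" using tail_shift by blast
  \<comment> \<open>Modulo 1, multiplying \<open>2 ^ i * x\<close> by \<open>2 ^ l - 1\<close> gives
    the difference of the tails at \<open>i + l\<close> and \<open>i\<close>, and multiplying by
    \<open>2 ^ l + 1\<close> gives their sum.\<close>
  define m :: nat where "m = (if s then 2 ^ l - 1 else 2 ^ l + 1)"
  have m: "odd m" "1 \<le> m" "m \<le> 2 ^ (l + 1)"
    using l one_le_power[of "2::nat" l] power_increasing[of 1 l "2::nat"] by (auto simp: m_def)
  have rm: "real m = (if s then 2 ^ l - 1 else 2 ^ l + 1)" by (auto simp: m_def of_nat_diff)
  have "dist_nearest_int (real (2 ^ i * m) * tail w 0) \<le> 1 / 2 ^ N"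
  proof (cases s)
    case True
    have "\<bar>tail w (i + l) - tail w i\<bar> \<le> 1 / 2 ^ N"
      by (rule tail_diff_le) (use s True in \<open>auto simp: ac_simps\<close>)
    moreover have "real (2 ^ i * m) * tail w 0 - of_int (n2 - n1) = tail w (i + l) - tail w i"
      using n1 n2 True by (simp add: rm power_add algebra_simps)
    ultimately show ?thesis using dist_nearest_int_le order_trans by metis
  next
    case False
    have "\<bar>tail w (i + l) + tail w i - 1\<bar> \<le> 1 / 2 ^ N"
      by (rule tail_sum_le) (use s False in \<open>auto simp: ac_simps\<close>)
    moreover have "real (2 ^ i * m) * tail w 0 - of_int (n2 + n1 + 1) = tail w (i + l) + tail w i - 1"
      using n1 n2 False by (simp add: rm power_add algebra_simps)
    ultimately show ?thesis using dist_nearest_int_le order_trans by metis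
  qed
  then have "real m * dist_nearest_int (real (2 ^ i * m) * tail w 0) \<le> 2 ^ (l + 1) * (1 / 2 ^ N)"
    using of_nat_mono[OF m(3), where ?'a = real]
    by (intro mult_mono) (auto simp: dist_nearest_int_def)
  then show ?thesis
    unfolding mult_padic_abs_2[OF m(1), of i, symmetric]
    using m(2) by (intro exI[of _ "2 ^ i * m"] conjI) simp_all
qed

text \<open>A positive liminf would bound the product below by some \<open>c > 0\<close> from some
  \<open>Q\<close> on. The surplus \<open>Q + K\<close> of a repetition is therefore spent twice:
  \<open>Q\<close> letters make \<open>q\<close> large, \<open>K\<close> letters make the product
  less than \<open>c\<close>.\<close>

lemma littlewood_of_nearly_periodic:
  assumes x: "base2_expansion x w" and w: "nearly_periodic w"
  shows "liminf (\<lambda>q::nat. ereal (real q * padic_abs 2 q * dist_nearest_int (real q * x))) = 0"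
proof -
  define f where "f q = real q * padic_abs 2 q * dist_nearest_int (real q * x)" for q :: nat
  have x: "x = tail w 0" using x by (simp add: base2_expansion_def tail_def sums_iff)
  have "0 \<le> f q" for q by (simp add: f_def padic_abs_def dist_nearest_int_def)
  then have "0 \<le> liminf (\<lambda>q. ereal (f q))" by (intro Liminf_bounded) auto
  moreover have "\<not> 0 < liminf (\<lambda>q. ereal (f q))"
  proof
    assume "0 < liminf (\<lambda>q. ereal (f q))"
    then obtain c where c: "0 < ereal c" "ereal c < liminf (\<lambda>q. ereal (f q))"
      using ereal_dense2 by blast
    then obtain Q where Q: "\<And>q. Q \<le> q \<Longrightarrow> c < f q"
      using less_LiminfD[OF c(2)] by (auto simp: eventually_sequentially)
    obtain K where K: "2 / 2 ^ K < c"
      using c(1) real_arch_pow_inv[of "c / 2" "1 / 2"] by (auto simp: power_one_over field_simps)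
    \<comment> \<open>Skipping the first \<open>Q\<close> letters of the repetition makes \<open>q\<close> a multiple of \<open>2 ^ Q\<close>, hence large.\<close>
    obtain i l s where l: "1 \<le> l" and s: "\<forall>j<l + (Q + K). (w (i + j) = w (i + j + l)) = s"
      using w[unfolded nearly_periodic_def, rule_format, of "Q + K"] by metis
    have "\<forall>j<l + K. (w (i + Q + j) = w (i + Q + j + l)) = s"
    proof (intro allI impI)
      fix j assume "j < l + K"
      then show "(w (i + Q + j) = w (i + Q + j + l)) = s"
        using s[rule_format, of "Q + j"] by (simp add: add.assoc)
    qed
    from small_value_of_repetition[OF l this] obtain q
      where q: "2 ^ (i + Q) \<le> q" "f q \<le> 2 ^ (l + 1) / 2 ^ (l + K)" by (auto simp: f_def x)
    have "(2::real) ^ (l + 1) / 2 ^ (l + K) = 2 / 2 ^ K" by (simp add: power_add)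
    then have "f q < c" using q(2) K by simp
    moreover have "Q \<le> 2 ^ (i + Q)" using less_exp[of "i + Q"] by linarith
    ultimately show False using Q[of q] q(1) by simp
  qed
  ultimately have "liminf (\<lambda>q. ereal (f q)) = 0" unfolding not_less by (rule antisym[rotated])
  then show ?thesis unfolding f_def .
qed

subsection \<open>Binary pure morphic words\<close>

lemma factor_of_middle:
  assumes "factor_of (u @ v @ r) w"
  shows "factor_of v w"
proof -
  obtain i where i: "\<And>j. j < length (u @ v @ r) \<Longrightarrow> w (i + j) = (u @ v @ r) ! j"
    using assms unfolding factor_of_def by blast
  have "w (i + length u + j) = v ! j" if "j < length v" for j
    using i[of "length u + j"] nth_append_middle[OF that, of u r] that by (simp add: add.assoc)
  then show ?thesis unfolding factor_of_def by blast
qed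

lemma overlap_free_factor:
  assumes "factor_of u w" "\<And>n. overlap_free w n"
  shows "overlap_free_list u"
  unfolding overlap_free_list_def overlap_free_def
proof (intro allI impI)
  fix i p assume p: "1 \<le> p" "i + 2 * p < length u"
  obtain k where k: "\<And>j. j < length u \<Longrightarrow> w (k + j) = u ! j"
    using assms unfolding factor_of_def by blast
  obtain j where j: "j \<le> p" "w (k + i + j) \<noteq> w (k + i + j + p)"
    using assms(2)[of "k + i + 2 * p + 1"] p(1) unfolding overlap_free_def by (metis less_add_one)
  then have "u ! (i + j) \<noteq> u ! (i + j + p)"
    using k[of "i + j"] k[of "i + j + p"] p by (simp add: add.assoc)
  then show "\<exists>j\<le>p. u ! (i + j) \<noteq> u ! (i + j + p)" using j(1) by blast
qed

text \<open>The square of \<open>q @ p\<close> gives the shift, and the trailing \<open>q\<close> is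
  the surplus beyond it.\<close>

lemma nearly_periodic_of_powers:
  assumes "\<And>K. \<exists>p q. factor_of ((q @ p) @ (q @ p) @ q) w \<and> q @ p \<noteq> [] \<and> K \<le> length q"
  shows "nearly_periodic w"
  unfolding nearly_periodic_def
proof
  fix K
  obtain p q where f: "factor_of ((q @ p) @ (q @ p) @ q) w" and ne: "q @ p \<noteq> []" and K: "K \<le> length q"
    using assms by blast
  let ?u = "(q @ p) @ (q @ p) @ q" and ?l = "length (q @ p)"
  obtain i where i: "\<And>j. j < length ?u \<Longrightarrow> w (i + j) = ?u ! j" using f unfolding factor_of_def by blast
  have "w (i + j) = w (i + j + ?l)" if "j < ?l + K" for j
  proof -
    have j: "j < length ((q @ p) @ q)" using that K by simp
    have "?u ! j = ((q @ p) @ q) ! j"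
      using nth_append_middle[OF j, of "[]" "p @ q"] by simp
    moreover have "?u ! (?l + j) = ((q @ p) @ q) ! j"
      using nth_append_middle[OF j, of "q @ p" "[]"] by simp
    ultimately show ?thesis using i[of j] i[of "?l + j"] j by (simp add: ac_simps)
  qed
  moreover have "1 \<le> ?l" using ne by (cases "q @ p") auto
  ultimately show "\<exists>i l s. 1 \<le> l \<and> (\<forall>j<l + K. (w (i + j) = w (i + j + l)) = s)"
    by (intro exI[of _ i] exI[of _ ?l] exI[of _ True]) auto
qed

lemma nearly_periodic_of_long_runs:
  assumes "\<And>n. factor_of (replicate n c) w"
  shows "nearly_periodic w"
proof (rule nearly_periodic_of_powers)
  fix K
  have "(replicate (Suc K) c @ []) @ (replicate (Suc K) c @ []) @ replicate (Suc K) c =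
      replicate (Suc K + Suc K + Suc K) c" by (simp only: replicate_add append_Nil2 append.assoc)
  then show "\<exists>p q. factor_of ((q @ p) @ (q @ p) @ q) w \<and> q @ p \<noteq> [] \<and> K \<le> length q"
    using assms[of "Suc K + Suc K + Suc K"]
    by (intro exI[of _ "[]"] exI[of _ "replicate (Suc K) c"]) auto
qed

lemma nearly_periodic_of_complements:
  assumes "\<And>K. \<exists>v. factor_of (v @ map Not v @ v) w \<and> v \<noteq> [] \<and> K \<le> length v"
  shows "nearly_periodic w"
  unfolding nearly_periodic_def
proof
  fix K
  obtain v where f: "factor_of (v @ map Not v @ v) w" and ne: "v \<noteq> []" and K: "K \<le> length v"
    using assms by blast
  let ?u = "v @ map Not v @ v" and ?l = "length v"
  obtain i where i: "\<And>j. j < length ?u \<Longrightarrow> w (i + j) = ?u ! j" using f unfolding factor_of_def by blast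
  have "w (i + j) \<noteq> w (i + j + ?l)" if "j < ?l + K" for j
  proof (cases "j < ?l")
    case True
    then show ?thesis using i[of j] i[of "j + ?l"] by (auto simp: nth_append ac_simps)
  next
    case False
    then show ?thesis using i[of j] i[of "j + ?l"] that K by (auto simp: nth_append ac_simps)
  qed
  moreover have "1 \<le> ?l" using ne by (cases v) auto
  ultimately show "\<exists>i l s. 1 \<le> l \<and> (\<forall>j<l + K. (w (i + j) = w (i + j + l)) = s)"
    by (intro exI[of _ i] exI[of _ ?l] exI[of _ False]) auto
qed

section \<open>Iterates of a morphism and their limit word\<close>

lemma morph_ext_funpow_append:
  "(morph_ext \<phi> ^^ n) (u @ v) = (morph_ext \<phi> ^^ n) u @ (morph_ext \<phi> ^^ n) v"
  by (induction n) auto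

lemma morph_ext_funpow_Nil: "(morph_ext \<phi> ^^ n) [] = []"
  by (induction n) auto

lemma morph_ext_funpow_Cons:
  "(morph_ext \<phi> ^^ n) (c # u) = (morph_ext \<phi> ^^ n) [c] @ (morph_ext \<phi> ^^ n) u"
  using morph_ext_funpow_append[of n \<phi> "[c]" u] by simp

lemma morph_ext_funpow_Suc_letter: "(morph_ext \<phi> ^^ Suc n) [c] = (morph_ext \<phi> ^^ n) (\<phi> c)"
  unfolding funpow_Suc_right by simp

locale morphic_word =
  fixes \<phi> :: "bool \<Rightarrow> bool list" and a :: bool and y :: "bool list" and w :: "nat \<Rightarrow> bool"
  assumes \<phi>a: "\<phi> a = a # y" and y: "y \<notin> lists (mortal_letters \<phi>)"
    and conv: "words_converge (\<lambda>n. (morph_ext \<phi> ^^ n) [a]) w"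
begin

abbreviation \<Phi> :: "nat \<Rightarrow> bool list \<Rightarrow> bool list" where
  "\<Phi> n \<equiv> morph_ext \<phi> ^^ n"

lemmas \<Phi>_append = morph_ext_funpow_append[of _ \<phi>]
  and \<Phi>_Cons = morph_ext_funpow_Cons[of _ \<phi>]
  and \<Phi>_Nil = morph_ext_funpow_Nil[of _ \<phi>]
  and \<Phi>_Suc = morph_ext_funpow_Suc_letter[of _ \<phi>]

text \<open>Since \<open>\<phi> a = a # y\<close>, each iterate is the previous one followed by an
  image of \<open>y\<close>.\<close>

lemma prefix_step: "\<Phi> (n + m) [a] = \<Phi> n [a] @ drop (length (\<Phi> n [a])) (\<Phi> (n + m) [a])"
proof (induction m)
  case (Suc m)
  have "\<Phi> (n + Suc m) [a] = \<Phi> (n + m) [a] @ \<Phi> (n + m) y"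
    by (simp only: add_Suc_right \<Phi>_Suc \<phi>a \<Phi>_Cons[of _ a y])
  then show ?case using Suc by (metis append.assoc append_eq_conv_conj)
qed auto

text \<open>Convergence fixes a letter only for large exponents; nesting of the iterates carries it
  back to every \<open>n\<close>.\<close>

lemma prefix_nth:
  assumes "i < length (\<Phi> n [a])"
  shows "\<Phi> n [a] ! i = w i"
proof -
  obtain N where N: "\<And>m. N \<le> m \<Longrightarrow> \<Phi> m [a] ! i = w i"
    using conv unfolding words_converge_def eventually_sequentially by blast
  have "\<Phi> (n + N) [a] ! i = \<Phi> n [a] ! i"
    by (subst prefix_step) (simp add: nth_append assms)
  then show ?thesis using N[of "n + N"] by simp
qed

lemma unbounded: "\<exists>n. K \<le> length (\<Phi> n [a])"
proof -
  obtain N where "\<And>m. N \<le> m \<Longrightarrow> K < length (\<Phi> m [a])"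
    using conv unfolding words_converge_def eventually_sequentially by blast
  from this[of N] show ?thesis by (intro exI[of _ N]) auto
qed

lemma factor_start: "factor_of (\<Phi> n [a]) w"
  unfolding factor_of_def using prefix_nth by (metis add_0)

text \<open>A factor lies inside some iterate of \<open>a\<close>, and its image lies inside the
  next iterate.\<close>

lemma factor_image:
  assumes "factor_of u w"
  shows "factor_of (morph_ext \<phi> u) w"
proof -
  obtain i where i: "\<And>j. j < length u \<Longrightarrow> w (i + j) = u ! j" using assms unfolding factor_of_def by blast
  obtain n where n: "i + length u \<le> length (\<Phi> n [a])" using unbounded by blast
  have "u = take (length u) (drop i (\<Phi> n [a]))"
    by (rule nth_equalityI) (use n i prefix_nth in auto)
  then have "\<Phi> n [a] = take i (\<Phi> n [a]) @ u @ drop (length u) (drop i (\<Phi> n [a]))"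
    by (metis append_take_drop_id)
  then have "morph_ext \<phi> (\<Phi> n [a]) = morph_ext \<phi> (take i (\<Phi> n [a])) @ morph_ext \<phi> u @
      morph_ext \<phi> (drop (length u) (drop i (\<Phi> n [a])))"
    by (metis morph_ext_simps(3))
  then show ?thesis using factor_start[of "Suc n"] factor_of_middle by (metis comp_apply funpow.simps(2))
qed

lemma factor_funpow: "factor_of u w \<Longrightarrow> factor_of (\<Phi> n u) w"
  by (induction n) (auto intro: factor_image)

lemma nearly_periodic_of_overlap:
  assumes "factor_of ((c # v) @ (c # v) @ [c]) w" and "\<And>K. \<exists>n. K \<le> length (\<Phi> n [c])"
  shows "nearly_periodic w"
proof (rule nearly_periodic_of_powers)
  fix K
  obtain n where n: "Suc K \<le> length (\<Phi> n [c])" using assms(2) by blast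
  have "\<Phi> n ((c # v) @ (c # v) @ [c]) = (\<Phi> n [c] @ \<Phi> n v) @ (\<Phi> n [c] @ \<Phi> n v) @ \<Phi> n [c]"
    by (simp only: \<Phi>_append \<Phi>_Cons[of _ c v])
  then have "factor_of ((\<Phi> n [c] @ \<Phi> n v) @ (\<Phi> n [c] @ \<Phi> n v) @ \<Phi> n [c]) w"
    using factor_funpow[OF assms(1)] by metis
  then show "\<exists>p q. factor_of ((q @ p) @ (q @ p) @ q) w \<and> q @ p \<noteq> [] \<and> K \<le> length q"
    using n by (intro exI[of _ "\<Phi> n v"] exI[of _ "\<Phi> n [c]"]) auto
qed

lemma nearly_periodic_overlap_free:
  assumes free: "\<And>n. overlap_free w n"
  shows "nearly_periodic w"
proof -
  obtain c where c: "factor_of (tm8 c) w" using tm8_factor[OF free] by blast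
  have factor: "factor_of (A @ B @ B @ A @ B @ A @ A @ B) w"
    if "A = \<Phi> n [c]" "B = \<Phi> n [\<not> c]" for n A B
  proof -
    have "tm8 c = [c] @ [\<not> c] @ [\<not> c] @ [c] @ [\<not> c] @ [c] @ [c] @ [\<not> c]" by (simp add: tm8_def)
    then have "\<Phi> n (tm8 c) = A @ B @ B @ A @ B @ A @ A @ B"
      unfolding that by (simp only: \<Phi>_append)
    then show ?thesis using factor_funpow[OF c] by metis
  qed
  show ?thesis
  proof (rule nearly_periodic_of_complements)
    fix K
    obtain n where n: "Suc K \<le> length (\<Phi> n [a])" using unbounded by blast
    define A B where "A = \<Phi> n [c]" and "B = \<Phi> n [\<not> c]"
    \<comment> \<open>One of \<open>c\<close> and \<open>\<not> c\<close> is \<open>a\<close>, so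
      one image is long. Once \<open>B = map Not A\<close> is known, both are.\<close>
    have AB: "Suc K \<le> length A \<or> Suc K \<le> length B"
      using n by (cases "a = c") (auto simp: A_def B_def)
    have f: "factor_of (A @ B @ B @ A @ B @ A @ A @ B) w" using factor A_def B_def by blast
    have B: "B = map Not A"
      by (rule complement_of_overlap_free_tm8[OF overlap_free_factor[OF f free]]) (use AB in auto)
    have "factor_of (A @ B @ A) w"
      using f factor_of_middle[of "A @ B @ B" "A @ B @ A" "A @ B" w] by simp
    then show "\<exists>v. factor_of (v @ map Not v @ v) w \<and> v \<noteq> [] \<and> K \<le> length v"
      using AB B by (intro exI[of _ A]) auto
  qed
qed

section \<open>Growth of the second letter, and the cases where it is erased or fixed\<close>

lemma non_mortal_letter: "\<exists>c\<in>set y. c \<notin> mortal_letters \<phi>"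
  using y by (auto simp: lists_eq_set)

text \<open>
  The letter \<open>a\<close> occurs at least twice in \<open>\<phi> a\<close>, so \<open>\<phi>\<^sup>3(a)\<close> is a power of \<open>\<phi> a\<close> with exponent
  at least 4.
\<close>

lemma nearly_periodic_erasing:
  assumes b: "\<phi> (\<not> a) = []"
  shows "nearly_periodic w"
proof -
  have "(\<not> a) \<in> mortal_letters \<phi>" unfolding mortal_letters_def using b by (auto intro!: exI[of _ 1])
  moreover obtain c where "c \<in> set y" "c \<notin> mortal_letters \<phi>" using non_mortal_letter by blast
  ultimately have "a \<in> set y" by (cases "c = a") auto
  then obtain u z where u: "y = u @ a # z" "a \<notin> set u" by (metis split_list_first)
  have "morph_ext \<phi> u = []" if "a \<notin> set u" for u
    using that
  proof (induction u)
    case (Cons d u)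
    then have "d = (\<not> a)" by (cases "d = a") auto
    then show ?case using Cons b by simp
  qed simp
  then have 2: "morph_ext \<phi> (\<phi> a) = \<phi> a @ \<phi> a @ morph_ext \<phi> z" using u \<phi>a by simp
  \<comment> \<open>An image is empty or starts with \<open>\<phi> a\<close>; either way a third
    copy of \<open>\<phi> a\<close> follows the first two in \<open>\<Phi> 3 [a]\<close>.\<close>
  have pref: "morph_ext \<phi> z = [] \<or> (\<exists>r. morph_ext \<phi> z = \<phi> a @ r)" for z
  proof (induction z)
    case (Cons d z)
    then show ?case using b by (cases "d = a") auto
  qed auto
  have "\<Phi> 3 [a] = \<phi> a @ \<phi> a @ morph_ext \<phi> z @ \<phi> a @ \<phi> a @ morph_ext \<phi> z @ morph_ext \<phi> (morph_ext \<phi> z)"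
    using 2 by (simp add: numeral_3_eq_3)
  moreover obtain r where "morph_ext \<phi> z @ \<phi> a @ \<phi> a @ morph_ext \<phi> z @ morph_ext \<phi> (morph_ext \<phi> z) = \<phi> a @ r"
    using pref[of z] by auto
  ultimately have "\<Phi> 3 [a] = [] @ ((a # y) @ (a # y) @ [a]) @ y @ r" using \<phi>a by simp
  then have "factor_of ((a # y) @ (a # y) @ [a]) w"
    using factor_start[of 3] factor_of_middle by metis
  then show ?thesis using nearly_periodic_of_overlap unbounded by blast
qed

text \<open>If \<open>\<phi> a\<close> ends in \<open>\<not> a\<close>, each iteration lengthens the
  final run of that letter. If it ends in \<open>a\<close>, write \<open>\<phi> a = a v a z\<close>
  with \<open>v\<close> free of \<open>a\<close>, hence fixed: the last letter of one
  \<open>\<phi> a\<close>, then \<open>v\<close>, then the next \<open>\<phi> a\<close> give the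
  overlap \<open>a v a v a\<close>.\<close>

lemma nearly_periodic_fixing:
  assumes b: "\<phi> (\<not> a) = [\<not> a]"
  shows "nearly_periodic w"
proof -
  have \<Phi>b: "\<Phi> n [\<not> a] = [\<not> a]" for n by (induction n) (auto simp: b)
  have "y \<noteq> []" using non_mortal_letter by auto
  then obtain u d where ud: "\<phi> a = u @ [d]" using \<phi>a by (metis append_butlast_last_id list.distinct(1))
  show ?thesis
  proof (cases "d = a")
    case False
    have "a \<in> set (\<phi> a)" using \<phi>a by simp
    then obtain u' r where r: "\<phi> a = u' @ a # r" "a \<notin> set r" by (metis split_list_last)
    have "r \<noteq> []" using r(1) ud False by auto
    have "e = (\<not> a)" if "e \<in> set r" for e using that r(2) by (cases "e = a") auto
    then obtain k where k: "r = replicate k (\<not> a)" using replicate_eqI[of r "length r" "\<not> a"] by blast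
    have "1 \<le> k" using k \<open>r \<noteq> []\<close> by (cases k) auto
    have "\<Phi> n (replicate k (\<not> a)) = replicate k (\<not> a)" for n k
    proof (induction k)
      case (Suc k)
      then show ?case using \<Phi>_Cons[of n "\<not> a" "replicate k (\<not> a)"] \<Phi>b by simp
    qed (simp add: \<Phi>_Nil)
    then have S: "\<Phi> (Suc n) [a] = \<Phi> n u' @ \<Phi> n [a] @ replicate k (\<not> a)" for n
      by (simp only: \<Phi>_Suc r k \<Phi>_append \<Phi>_Cons[of _ a "replicate k (\<not> a)"])
    have "\<exists>v. \<Phi> n [a] = v @ replicate (n * k) (\<not> a)" for n
    proof (induction n)
      case (Suc n)
      then obtain v where "\<Phi> n [a] = v @ replicate (n * k) (\<not> a)" by blast
      then have "\<Phi> (Suc n) [a] = (\<Phi> n u' @ v) @ replicate (n * k + k) (\<not> a)"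
        unfolding S replicate_add by simp
      then show ?case by (metis add.commute mult_Suc)
    qed auto
    moreover have "replicate (n * k) (\<not> a) = replicate n (\<not> a) @ replicate (n * k - n) (\<not> a)" for n
      using \<open>1 \<le> k\<close> by (simp flip: replicate_add)
    ultimately have "factor_of (replicate n (\<not> a)) w" for n
      using factor_start[of n] factor_of_middle by metis
    then show ?thesis by (rule nearly_periodic_of_long_runs)
  next
    case True
    have "last (a # y) = d" using ud \<phi>a last_snoc by metis
    then have "a \<in> set y" using \<open>y \<noteq> []\<close> last_in_set[of y] True by simp
    then obtain v z where v: "y = v @ a # z" "a \<notin> set v" by (metis split_list_first)
    have "morph_ext \<phi> v = v" if "a \<notin> set v" for v
      using that
    proof (induction v)
      case (Cons d v)
      then have "d = (\<not> a)" by (cases "d = a") auto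
      then show ?case using Cons b by simp
    qed simp
    then have "morph_ext \<phi> (\<phi> a) = \<phi> a @ v @ \<phi> a @ morph_ext \<phi> z" using v \<phi>a by simp
    also have "\<dots> = u @ [a] @ v @ \<phi> a @ morph_ext \<phi> z" using ud True by simp
    also have "\<dots> = u @ ((a # v) @ (a # v) @ [a]) @ z @ morph_ext \<phi> z" using \<phi>a v(1) by simp
    finally have "\<Phi> 2 [a] = \<dots>" by (simp add: numeral_2_eq_2)
    then have "factor_of ((a # v) @ (a # v) @ [a]) w"
      using factor_start[of 2] factor_of_middle by metis
    then show ?thesis using nearly_periodic_of_overlap unbounded by blast
  qed
qed

text \<open>Either \<open>a\<close> occurs in the image of \<open>\<not> a\<close> and passes on its
  growth, or that image is a power of \<open>\<not> a\<close> with exponent at least 2.\<close>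

lemma unbounded_other:
  assumes "\<phi> (\<not> a) \<noteq> []" "\<phi> (\<not> a) \<noteq> [\<not> a]"
  shows "\<exists>n. K \<le> length (\<Phi> n [\<not> a])"
proof (cases "a \<in> set (\<phi> (\<not> a))")
  case True
  then obtain u v where "\<phi> (\<not> a) = u @ [a] @ v" by (metis split_list append_Cons append_Nil)
  then have "\<Phi> (Suc n) [\<not> a] = \<Phi> n u @ \<Phi> n [a] @ \<Phi> n v" for n
    by (simp only: \<Phi>_Suc \<Phi>_append)
  moreover obtain n where "K \<le> length (\<Phi> n [a])" using unbounded by blast
  ultimately have "K \<le> length (\<Phi> (Suc n) [\<not> a])" by simp
  then show ?thesis by blast
next
  case False
  then have all: "c = (\<not> a)" if "c \<in> set (\<phi> (\<not> a))" for c using that by (cases "c = a") auto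
  obtain d e r where "\<phi> (\<not> a) = [d] @ [e] @ r"
    using assms all by (cases "\<phi> (\<not> a)"; cases "tl (\<phi> (\<not> a))") auto
  then have "\<phi> (\<not> a) = [\<not> a] @ [\<not> a] @ r" using all[of d] all[of e] by simp
  then have S: "\<Phi> (Suc n) [\<not> a] = \<Phi> n [\<not> a] @ \<Phi> n [\<not> a] @ \<Phi> n r" for n
    by (simp only: \<Phi>_Suc \<Phi>_append)
  have "Suc n \<le> length (\<Phi> n [\<not> a])" for n
  proof (induction n)
    case (Suc n)
    then show ?case unfolding S by simp
  qed simp
  then show ?thesis using Suc_leD by blast
qed

lemma nearly_periodic_morphic: "nearly_periodic w"
proof (cases "\<forall>n. overlap_free w n")
  case True
  then show ?thesis using nearly_periodic_overlap_free by blast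
next
  case False
  then obtain c v where cv: "factor_of ((c # v) @ (c # v) @ [c]) w" using overlap_of_not_free by blast
  show ?thesis
  proof (cases "\<phi> (\<not> a) = [] \<or> \<phi> (\<not> a) = [\<not> a]")
    case True
    then show ?thesis using nearly_periodic_erasing nearly_periodic_fixing by blast
  next
    case False
    \<comment> \<open>Both letters grow here, so it does not matter which one the overlap begins
      with.\<close>
    then have "\<exists>n. K \<le> length (\<Phi> n [c])" for K
      using unbounded[of K] unbounded_other[of K] by (cases "c = a") auto
    then show ?thesis using nearly_periodic_of_overlap[OF cv] by blast
  qed
qed

end

theorem theorem2p11:
  fixes x :: real and w :: "nat \<Rightarrow> bool"
  assumes "x \<in> {0..1}"
    and "base2_expansion x w"
    and "pure_morphic w"
  shows "liminf (\<lambda>q::nat. ereal (real q * padic_abs 2 q * dist_nearest_int (real q * x))) = 0"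
proof -
  obtain \<phi> a y where "morphic_word \<phi> a y w"
    using assms(3) unfolding pure_morphic_def prolongable_def morphic_word_def by blast
  then show ?thesis
    using littlewood_of_nearly_periodic[OF assms(2)] morphic_word.nearly_periodic_morphic by blast
qed

end
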